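(* Let $d\ge1$. Assume $f\in C^2(0,+\infty)$ is convex, satisfies $f(1)=0$, and $x\mapsto xf'(x)$ is concave on $(0,+\infty)$. Then for any smooth, positive probability density $\rho^*$ on $\mathbb R^d$, the $f$-divergence $\rho\mapsto D_f[\rho\Vert\rho^*]$ is geodesically convex on $\mathcal P$ within the Fisher-Rao geometry. Furthermore, when $f''(1)>0$, there exists a constant $\alpha_f>0$ depending solely on $f$ such that, for any smooth, positive probability density $\rho^*$, $D_f[\cdot\Vert\rho^*]$ is $\alpha_f$-strongly geodesically convex. These assumptions (convexity, concavity of $xf'(x)$, and $f''(1)>0$) are satisfied for $f$ with $f''(x)=x^p$ and $f(1)=0$, for $p\le-2$.
   Context: $\mathcal P=\{\rho\in C^\infty(\mathbb R^d):\int\rho\,d\theta=1,\ \rho>0\}$ and $D_f[\rho\Vert\rho^*]=\int\rho^*f(\rho/\rho^* )\,d\theta$. Tangent vectors at $\rho\in\mathcal P$ are written $\sigma=\rho(\psi-\mathbb E_\rho[\psi])$ with $\psi$ a smooth function on $\mathbb R^d$, where $\mathbb E_\rho[\psi]=\int\rho\psi\,d\theta$. The Fisher-Rao metric is $g^{\mathrm{FR}}_\rho(\sigma_1,\sigma_2)=\int\frac{\sigma_1\sigma_2}{\rho}\,d\theta$. Its constant-speed geodesics satisfy $\partial_t\rho_t=\rho_t(\psi_t-\mathbb E_{\rho_t}[\psi_t])$, $\partial_t\psi_t=-\frac12(\psi_t-\mathbb E_{\rho_t}[\psi_t])^2$. The Fisher-Rao Hessian of an energy is its second derivative along the geodesic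 starting at $\rho$ with velocity $\sigma$; for the $f$-divergence it is given by $$g^{\mathrm{FR}}_\rho(\mathrm{Hess}_{\mathrm{FR}}D_f[\rho\Vert\rho^*]\sigma,\sigma)=\int f''\bigl(\tfrac{\rho}{\rho^*}\bigr)\frac{\rho^2(\psi-\mathbb E_\rho[\psi])^2}{\rho^*}\,d\theta+\frac12\int\rho(\psi-\mathbb E_\rho[\psi])^2\Bigl(f'\bigl(\tfrac{\rho}{\rho^*}\bigr)-\mathbb E_\rho\bigl[f'\bigl(\tfrac{\rho}{\rho^*}\bigr)\bigr]\Bigr)d\theta .$$ Geodesic convexity means that this quantity is $\ge0$ for all $\rho\in\mathcal P$ and all tangent vectors $\sigma$ at $\rho$ for which all the integrals involved converge absolutely; $\alpha$-strong geodesic convexity ($\alpha>0$) means that for all such $\rho,\sigma$ it is $\ge\alpha\,g^{\mathrm{FR}}_\rho(\sigma,\sigma)$. *)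

theory Defs
  imports "HOL-Analysis.Analysis"
begin

text \<open>
  The constant of strong convexity must not depend on the dimension, so the dimension \<open>d\<close> has
  to be an ordinary natural number that can be quantified inside a formula. Points of Euclidean
  \<open>d\<close>-space are therefore extensional functions on \<open>{..<d}\<close>, and Lebesgue measure is the
  \<open>d\<close>-fold product of \<open>lborel\<close>. The library topology on \<open>nat \<Rightarrow> real\<close> is the product topology,
  which on the set \<open>Rn d\<close> induces the Euclidean one.
\<close>

definition Rn :: "nat \<Rightarrow> (nat \<Rightarrow> real) set" where
  "Rn d = ({..<d} \<rightarrow>\<^sub>E UNIV)"

definition leb :: "nat \<Rightarrow> (nat \<Rightarrow> real) measure" where
  "leb d = (\<Pi>\<^sub>M i\<in>{..<d}. lborel)"

definition partial_deriv :: "nat \<Rightarrow> ((nat \<Rightarrow> real) \<Rightarrow> real) \<Rightarrow> (nat \<Rightarrow> real) \<Rightarrow> real" where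
  "partial_deriv i u x = deriv (\<lambda>t. u (x(i := t))) (x i)"

primrec Ck :: "nat \<Rightarrow> nat \<Rightarrow> ((nat \<Rightarrow> real) \<Rightarrow> real) \<Rightarrow> bool" where
  "Ck d 0 u \<longleftrightarrow> continuous_on (Rn d) u"
| "Ck d (Suc k) u \<longleftrightarrow> continuous_on (Rn d) u \<and>
     (\<forall>i<d. (\<forall>x\<in>Rn d. (\<lambda>t. u (x(i := t))) differentiable (at (x i))) \<and>
            Ck d k (partial_deriv i u))"

definition smooth :: "nat \<Rightarrow> ((nat \<Rightarrow> real) \<Rightarrow> real) \<Rightarrow> bool" where
  "smooth d u \<longleftrightarrow> (\<forall>k. Ck d k u)"

definition densities :: "nat \<Rightarrow> ((nat \<Rightarrow> real) \<Rightarrow> real) set" where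
  "densities d =
     {\<rho>. smooth d \<rho> \<and> (\<forall>x\<in>Rn d. \<rho> x > 0) \<and> has_bochner_integral (leb d) \<rho> 1}"

definition expect ::
  "nat \<Rightarrow> ((nat \<Rightarrow> real) \<Rightarrow> real) \<Rightarrow> ((nat \<Rightarrow> real) \<Rightarrow> real) \<Rightarrow> real" where
  "expect d \<rho> \<psi> = (\<integral>x. \<rho> x * \<psi> x \<partial>leb d)"

definition tangent ::
  "nat \<Rightarrow> ((nat \<Rightarrow> real) \<Rightarrow> real) \<Rightarrow> ((nat \<Rightarrow> real) \<Rightarrow> real) \<Rightarrow> (nat \<Rightarrow> real) \<Rightarrow> real" where
  "tangent d \<rho> \<psi> x = \<rho> x * (\<psi> x - expect d \<rho> \<psi>)"

definition fisher_rao_metric ::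
  "nat \<Rightarrow> ((nat \<Rightarrow> real) \<Rightarrow> real) \<Rightarrow> ((nat \<Rightarrow> real) \<Rightarrow> real) \<Rightarrow> ((nat \<Rightarrow> real) \<Rightarrow> real) \<Rightarrow> real" where
  "fisher_rao_metric d \<rho> \<sigma>\<^sub>1 \<sigma>\<^sub>2 = (\<integral>x. \<sigma>\<^sub>1 x * \<sigma>\<^sub>2 x / \<rho> x \<partial>leb d)"

text \<open>
  The Fisher-Rao Hessian of the \<open>f\<close>-divergence \<open>\<rho> \<mapsto> \<integral> \<rho>s f(\<rho>/\<rho>s)\<close> at \<open>\<rho>\<close>, evaluated on the
  tangent vector \<open>tangent d \<rho> \<psi>\<close>: the second derivative of the divergence at time \<open>0\<close> along the
  geodesic \<open>\<rho>' = \<rho> (\<psi> - E \<psi>)\<close>, \<open>\<psi>' = - (\<psi> - E \<psi>)\<^sup>2 / 2\<close> (\<open>E\<close> the expectation under the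
  current \<open>\<rho>\<close>), where \<open>\<rho>'' = \<rho> ((\<psi> - E \<psi>)\<^sup>2 - E ((\<psi> - E \<psi>)\<^sup>2)) / 2\<close>.
  The two integrands are named so that their integrability can be stated.
\<close>

definition hess_integrand1 ::
  "nat \<Rightarrow> (real \<Rightarrow> real) \<Rightarrow> ((nat \<Rightarrow> real) \<Rightarrow> real) \<Rightarrow> ((nat \<Rightarrow> real) \<Rightarrow> real) \<Rightarrow>
   ((nat \<Rightarrow> real) \<Rightarrow> real) \<Rightarrow> (nat \<Rightarrow> real) \<Rightarrow> real" where
  "hess_integrand1 d f \<rho>s \<rho> \<psi> x =
     deriv (deriv f) (\<rho> x / \<rho>s x) * ((\<rho> x)\<^sup>2 * (\<psi> x - expect d \<rho> \<psi>)\<^sup>2 / \<rho>s x)"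

definition hess_integrand2 ::
  "nat \<Rightarrow> (real \<Rightarrow> real) \<Rightarrow> ((nat \<Rightarrow> real) \<Rightarrow> real) \<Rightarrow> ((nat \<Rightarrow> real) \<Rightarrow> real) \<Rightarrow>
   ((nat \<Rightarrow> real) \<Rightarrow> real) \<Rightarrow> (nat \<Rightarrow> real) \<Rightarrow> real" where
  "hess_integrand2 d f \<rho>s \<rho> \<psi> x =
     \<rho> x * (\<psi> x - expect d \<rho> \<psi>)\<^sup>2 *
       (deriv f (\<rho> x / \<rho>s x) - expect d \<rho> (\<lambda>y. deriv f (\<rho> y / \<rho>s y)))"

definition fisher_rao_hessian ::
  "nat \<Rightarrow> (real \<Rightarrow> real) \<Rightarrow> ((nat \<Rightarrow> real) \<Rightarrow> real) \<Rightarrow> ((nat \<Rightarrow> real) \<Rightarrow> real) \<Rightarrow>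
   ((nat \<Rightarrow> real) \<Rightarrow> real) \<Rightarrow> real" where
  "fisher_rao_hessian d f \<rho>s \<rho> \<psi> =
     (\<integral>x. hess_integrand1 d f \<rho>s \<rho> \<psi> x \<partial>leb d)
     + 1/2 * (\<integral>x. hess_integrand2 d f \<rho>s \<rho> \<psi> x \<partial>leb d)"

definition hess_converges ::
  "nat \<Rightarrow> (real \<Rightarrow> real) \<Rightarrow> ((nat \<Rightarrow> real) \<Rightarrow> real) \<Rightarrow> ((nat \<Rightarrow> real) \<Rightarrow> real) \<Rightarrow>
   ((nat \<Rightarrow> real) \<Rightarrow> real) \<Rightarrow> bool" where
  "hess_converges d f \<rho>s \<rho> \<psi> \<longleftrightarrow>
     integrable (leb d) (\<lambda>x. \<rho> x * \<psi> x) \<and>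
     integrable (leb d) (\<lambda>x. \<rho> x * deriv f (\<rho> x / \<rho>s x)) \<and>
     integrable (leb d) (hess_integrand1 d f \<rho>s \<rho> \<psi>) \<and>
     integrable (leb d) (hess_integrand2 d f \<rho>s \<rho> \<psi>)"

definition geodesically_convex ::
  "nat \<Rightarrow> (real \<Rightarrow> real) \<Rightarrow> ((nat \<Rightarrow> real) \<Rightarrow> real) \<Rightarrow> bool" where
  "geodesically_convex d f \<rho>s \<longleftrightarrow>
     (\<forall>\<rho>\<in>densities d. \<forall>\<psi>. smooth d \<psi> \<longrightarrow> hess_converges d f \<rho>s \<rho> \<psi> \<longrightarrow>
        fisher_rao_hessian d f \<rho>s \<rho> \<psi> \<ge> 0)"

definition strongly_geodesically_convex ::
  "real \<Rightarrow> nat \<Rightarrow> (real \<Rightarrow> real) \<Rightarrow> ((nat \<Rightarrow> real) \<Rightarrow> real) \<Rightarrow> bool" where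
  "strongly_geodesically_convex \<alpha> d f \<rho>s \<longleftrightarrow>
     (\<forall>\<rho>\<in>densities d. \<forall>\<psi>. smooth d \<psi> \<longrightarrow> hess_converges d f \<rho>s \<rho> \<psi> \<longrightarrow>
        integrable (leb d) (\<lambda>x. tangent d \<rho> \<psi> x * tangent d \<rho> \<psi> x / \<rho> x) \<longrightarrow>
        fisher_rao_hessian d f \<rho>s \<rho> \<psi>
          \<ge> \<alpha> * fisher_rao_metric d \<rho> (tangent d \<rho> \<psi>) (tangent d \<rho> \<psi>))"

definition C2_pos :: "(real \<Rightarrow> real) \<Rightarrow> bool" where
  "C2_pos f \<longleftrightarrow>
     (\<forall>x>0. f differentiable (at x)) \<and>
     (\<forall>x>0. deriv f differentiable (at x)) \<and>
     continuous_on {0<..} (deriv (deriv f))"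

definition entropy_assms :: "(real \<Rightarrow> real) \<Rightarrow> bool" where
  "entropy_assms f \<longleftrightarrow>
     C2_pos f \<and> convex_on {0<..} f \<and> f 1 = 0 \<and> concave_on {0<..} (\<lambda>x. x * deriv f x)"

end

(*
  Write \<open>r = \<rho>/\<rho>s\<close> and \<open>h x = x * f' x\<close>. The first Hessian integrand plus half
  the second is \<open>\<rho> (\<psi> - E \<psi>)\<^sup>2 (r f''(r) + (f'(r) - E\<^sub>\<rho>[f'(r)]) / 2)\<close>. Jensen's inequality for the concave \<open>h\<close> and the
  probability density \<open>\<rho>s\<close> gives \<open>E\<^sub>\<rho>[f'(r)] = E\<^sub>\<rho>\<^sub>s[h(r)] \<le> h(1) = f'(1)\<close>, so it suffices to bound
  \<open>r f''(r) + (f'(r) - f'(1)) / 2\<close> from below. For \<open>r \<le> 1\<close> the monotonicity of \<open>h' = f' + x f''\<close> gives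
  \<open>r f''(r) \<ge> f''(1) + f'(1) - f'(r)\<close>; for \<open>r \<ge> 1\<close> both terms are nonnegative, and either \<open>r\<close> is near
  \<open>1\<close>, where \<open>f''\<close> is bounded below, or \<open>f'(r) - f'(1)\<close> is.
*)
theory Submission
  imports Defs
begin

section \<open>One-variable inequalities\<close>

text \<open>Adding the tangent-line inequalities at \<open>x\<close> and at \<open>y\<close> cancels
  the values of \<open>f\<close>. The function is arbitrary because both \<open>f\<close> and the
  negative of \<open>x * deriv f x\<close> are fed in.\<close>

lemma convex_on_deriv_mono:
  fixes f :: "real \<Rightarrow> real"
  assumes conv: "convex_on {0<..} f"
    and der: "\<And>x. x > 0 \<Longrightarrow> (f has_real_derivative f' x) (at x)"
    and "0 < x" "x \<le> y"
  shows "f' x \<le> f' y"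
proof (cases "x = y")
  case False
  have tangent: "f' a * (b - a) \<le> f b - f a" if "a > 0" "b > 0" for a b
    using that conv der[of a]
    by (intro convex_on_imp_above_tangent[of "{0<..}"])
       (auto simp: connected_Ioi interior_open has_field_derivative_at_within)
  have "f' x * (y - x) + f' y * (x - y) \<le> 0"
    using tangent[of x y] tangent[of y x] assms(3,4) by linarith
  then have "(f' x - f' y) * (y - x) \<le> 0" by (simp add: algebra_simps)
  then show ?thesis using False assms(3,4) by (simp add: mult_le_0_iff)
qed simp

text \<open>Densities are required to be positive on \<open>Rn d\<close>; this gives positivity at
  every point of integration.\<close>

lemma space_leb: "space (leb d) = Rn d"
  by (simp add: leb_def Rn_def space_PiM)

context
  fixes f :: "real \<Rightarrow> real"
  assumes ent: "entropy_assms f"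
begin

lemma entropy_has_deriv:
  assumes "x > 0"
  shows "(f has_real_derivative deriv f x) (at x)"
    and "(deriv f has_real_derivative deriv (deriv f) x) (at x)"
  using ent assms
  by (auto simp: entropy_assms_def C2_pos_def DERIV_deriv_iff_real_differentiable)

lemma entropy_deriv_mono:
  assumes "0 < x" "x \<le> y"
  shows "deriv f x \<le> deriv f y"
  using convex_on_deriv_mono[OF _ entropy_has_deriv(1) assms] ent
  by (simp add: entropy_assms_def)

lemma entropy_deriv2_nonneg:
  assumes "x > 0"
  shows "deriv (deriv f) x \<ge> 0"
proof (rule mono_on_imp_deriv_nonneg)
  show "mono_on {0<..} (deriv f)"
    by (auto simp: mono_on_def intro: entropy_deriv_mono)
qed (use assms entropy_has_deriv(2) in \<open>auto simp: interior_open\<close>)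

text \<open>The sign is flipped so that the tangent and monotonicity facts for convex functions
  apply to the concave \<open>x * deriv f x\<close>.\<close>

lemma entropy_concave_deriv:
  assumes "x > 0"
  shows "((\<lambda>x. - (x * deriv f x)) has_real_derivative
           - (deriv f x + x * deriv (deriv f) x)) (at x)"
  using entropy_has_deriv(2)[OF assms]
  by (auto intro!: derivative_eq_intros)

lemma entropy_convex_neg: "convex_on {0<..} (\<lambda>x. - (x * deriv f x))"
  using ent by (simp add: entropy_assms_def concave_on_def)

text \<open>A concave function lies below its tangent at 1. This is the pointwise form of the Jensen
  step: the right side is affine in \<open>x\<close>, so it can be integrated exactly.\<close>

lemma entropy_tangent_at_1:
  assumes "x > 0"
  shows "x * deriv f x \<le> deriv f 1 + (deriv f 1 + deriv (deriv f) 1) * (x - 1)"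
proof -
  have "- (deriv f 1 + 1 * deriv (deriv f) 1) * (x - 1) \<le> - (x * deriv f x) - - (1 * deriv f 1)"
    using assms entropy_convex_neg entropy_concave_deriv[of 1]
    by (intro convex_on_imp_above_tangent[of "{0<..}" "\<lambda>x. - (x * deriv f x)"])
       (auto simp: connected_Ioi interior_open has_field_derivative_at_within)
  then show ?thesis by (simp add: algebra_simps)
qed

lemma entropy_lower_bound_left:
  assumes "0 < r" "r \<le> 1"
  shows "r * deriv (deriv f) r + (deriv f r - deriv f 1) / 2 \<ge> deriv (deriv f) 1"
proof -
  have "- (deriv f r + r * deriv (deriv f) r) \<le> - (deriv f 1 + 1 * deriv (deriv f) 1)"
    using convex_on_deriv_mono[OF entropy_convex_neg entropy_concave_deriv assms] .
  moreover have "deriv f r \<le> deriv f 1"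
    using entropy_deriv_mono assms by simp
  \<comment> \<open>Half of the loss \<open>deriv f 1 - deriv f r\<close> is left over, and it is
    nonnegative.\<close>
  ultimately show ?thesis by argo
qed

lemma entropy_lower_bound_0:
  assumes "r > 0"
  shows "r * deriv (deriv f) r + (deriv f r - deriv f 1) / 2 \<ge> 0"
proof (cases "r \<le> 1")
  case True
  then show ?thesis
    using entropy_lower_bound_left[of r] entropy_deriv2_nonneg[of 1] assms by simp
next
  case False
  then show ?thesis
    using entropy_deriv2_nonneg[of r] entropy_deriv_mono[of 1 r] by simp
qed

lemma entropy_lower_bound_pos:
  assumes "deriv (deriv f) 1 > 0"
  obtains \<alpha> where "\<alpha> > 0"
    "\<And>r. r > 0 \<Longrightarrow> r * deriv (deriv f) r + (deriv f r - deriv f 1) / 2 \<ge> \<alpha>"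
proof -
  \<comment> \<open>Half of the value at 1, so that continuity keeps the second derivative above
    \<open>c\<close> near 1.\<close>
  define c where "c = deriv (deriv f) 1 / 2"
  have c: "c > 0" using assms by (simp add: c_def)
  have "isCont (deriv (deriv f)) 1"
    using ent by (auto simp: entropy_assms_def C2_pos_def continuous_on_eq_continuous_at)
  then obtain e where e: "e > 0"
    "\<And>x. dist x 1 < e \<Longrightarrow> dist (deriv (deriv f) x) (deriv (deriv f) 1) < c"
    using c unfolding continuous_at_eps_delta dist_real_def by blast
  \<comment> \<open>Halving keeps the closed interval from 1 to 1 + \<delta> inside the open ball of
    radius \<open>e\<close>.\<close>
  define \<delta> where "\<delta> = e / 2"
  have \<delta>: "\<delta> > 0" using e by (simp add: \<delta>_def)
  have near: "deriv (deriv f) x \<ge> c" if "1 \<le> x" "x \<le> 1 + \<delta>" for x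
  proof -
    have "dist x 1 < e" using that e(1) by (simp add: dist_real_def \<delta>_def field_simps)
    from e(2)[OF this] show ?thesis by (simp add: dist_real_def c_def abs_if split: if_splits)
  qed
  have far: "deriv f (1 + \<delta>) - deriv f 1 \<ge> c * \<delta>"
  proof -
    have "\<exists>z>1. z < 1 + \<delta> \<and> deriv f (1 + \<delta>) - deriv f 1 = (1 + \<delta> - 1) * deriv (deriv f) z"
      using \<delta> by (intro MVT2 entropy_has_deriv(2)) auto
    then show ?thesis using near \<delta> by (auto simp: mult.commute intro!: mult_left_mono)
  qed
  show ?thesis
  \<comment> \<open>\<open>c\<close> serves up to 1 + \<delta>; beyond it, half the increment of
    \<open>deriv f\<close> does. Both numbers come from \<open>f\<close> alone, so the constant is
    independent of dimension and densities.\<close>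
  proof (rule that[of "min c (c * \<delta> / 2)"])
    show "min c (c * \<delta> / 2) > 0" using c \<delta> by simp
  next
    fix r :: real assume r: "r > 0"
    consider "r \<le> 1" | "1 \<le> r" "r \<le> 1 + \<delta>" | "1 + \<delta> \<le> r" by linarith
    then show "min c (c * \<delta> / 2) \<le> r * deriv (deriv f) r + (deriv f r - deriv f 1) / 2"
    proof cases
      case 1
      then show ?thesis using entropy_lower_bound_left[OF r 1] assms c_def by linarith
    next
      case 2
      have "1 * c \<le> r * deriv (deriv f) r"
        using 2 near[of r] c by (intro mult_mono) auto
      moreover have "deriv f 1 \<le> deriv f r" using entropy_deriv_mono 2 by simp
      ultimately have "c \<le> r * deriv (deriv f) r + (deriv f r - deriv f 1) / 2" by argo
      then show ?thesis by (rule min.coboundedI1)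
    next
      case 3
      have "0 \<le> r * deriv (deriv f) r" using entropy_deriv2_nonneg r by simp
      moreover have "deriv f (1 + \<delta>) \<le> deriv f r" using entropy_deriv_mono \<delta> 3 by simp
      ultimately have "c * \<delta> / 2 \<le> r * deriv (deriv f) r + (deriv f r - deriv f 1) / 2"
        using far by argo
      then show ?thesis by (rule min.coboundedI2)
    qed
  qed
qed

section \<open>The Hessian bound\<close>

text \<open>The tangent bound at the density ratio, multiplied by \<open>\<rho>s x\<close>, is
  integrated. Its slope term vanishes because both densities have mass 1.\<close>

lemma expect_deriv_le:
  assumes "\<rho>s \<in> densities d" "\<rho> \<in> densities d"
    and int: "integrable (leb d) (\<lambda>x. \<rho> x * deriv f (\<rho> x / \<rho>s x))"
  shows "expect d \<rho> (\<lambda>y. deriv f (\<rho> y / \<rho>s y)) \<le> deriv f 1"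
proof -
  define k where "k = deriv f 1 + deriv (deriv f) 1"
  have s: "has_bochner_integral (leb d) \<rho>s 1" and r: "has_bochner_integral (leb d) \<rho> 1"
    using assms by (auto simp: densities_def)
  have I: "has_bochner_integral (leb d) (\<lambda>x. deriv f 1 * \<rho>s x + k * (\<rho> x - \<rho>s x))
             (deriv f 1 * 1 + k * (1 - 1))"
    by (intro has_bochner_integral_add has_bochner_integral_mult_right
          has_bochner_integral_diff s r)
  have "(\<integral>x. \<rho> x * deriv f (\<rho> x / \<rho>s x) \<partial>leb d)
          \<le> (\<integral>x. deriv f 1 * \<rho>s x + k * (\<rho> x - \<rho>s x) \<partial>leb d)"
  proof (rule integral_mono[OF int])
    show "integrable (leb d) (\<lambda>x. deriv f 1 * \<rho>s x + k * (\<rho> x - \<rho>s x))"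
      using I by (simp add: has_bochner_integral_iff)
  next
    fix x assume "x \<in> space (leb d)"
    then have pos: "\<rho> x > 0" "\<rho>s x > 0"
      using assms by (auto simp: densities_def space_leb)
    then have "(\<rho> x / \<rho>s x) * deriv f (\<rho> x / \<rho>s x) \<le> deriv f 1 + k * (\<rho> x / \<rho>s x - 1)"
      unfolding k_def by (intro entropy_tangent_at_1) simp
    then have "\<rho>s x * ((\<rho> x / \<rho>s x) * deriv f (\<rho> x / \<rho>s x))
                 \<le> \<rho>s x * (deriv f 1 + k * (\<rho> x / \<rho>s x - 1))"
      using pos by (intro mult_left_mono) auto
    then show "\<rho> x * deriv f (\<rho> x / \<rho>s x) \<le> deriv f 1 * \<rho>s x + k * (\<rho> x - \<rho>s x)"
      using pos by (simp add: algebra_simps)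
  qed
  also have "\<dots> = deriv f 1"
    using has_bochner_integral_integral_eq[OF I] by simp
  finally show ?thesis by (simp add: expect_def)
qed

lemma hessian_integrand_ge:
  assumes dens: "\<rho>s \<in> densities d" "\<rho> \<in> densities d" and x: "x \<in> Rn d"
    and int: "integrable (leb d) (\<lambda>x. \<rho> x * deriv f (\<rho> x / \<rho>s x))"
    and bound: "\<And>r. r > 0 \<Longrightarrow> r * deriv (deriv f) r + (deriv f r - deriv f 1) / 2 \<ge> \<alpha>"
  shows "\<alpha> * (tangent d \<rho> \<psi> x * tangent d \<rho> \<psi> x / \<rho> x)
           \<le> hess_integrand1 d f \<rho>s \<rho> \<psi> x + 1/2 * hess_integrand2 d f \<rho>s \<rho> \<psi> x"
proof -
  have pos: "\<rho> x > 0" "\<rho>s x > 0"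
    using dens x by (auto simp: densities_def)
  define r where "r = \<rho> x / \<rho>s x"
  define E where "E = expect d \<rho> (\<lambda>y. deriv f (\<rho> y / \<rho>s y))"
  \<comment> \<open>The metric integrand is \<open>w\<close> itself, and both Hessian integrands are
    multiples of it, so only a scalar inequality in \<open>r\<close> remains.\<close>
  define w where "w = \<rho> x * (\<psi> x - expect d \<rho> \<psi>)\<^sup>2"
  have "E \<le> deriv f 1" unfolding E_def by (rule expect_deriv_le[OF dens int])
  moreover have "r > 0" using pos by (simp add: r_def)
  \<comment> \<open>Replacing \<open>deriv f 1\<close> by the smaller \<open>E\<close> only raises
    the expression.\<close>
  ultimately have "\<alpha> \<le> r * deriv (deriv f) r + (deriv f r - E) / 2"
    using bound[of r] by argo
  then have "w * \<alpha> \<le> w * (r * deriv (deriv f) r + (deriv f r - E) / 2)"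
    using pos by (intro mult_left_mono) (simp_all add: w_def)
  moreover have "tangent d \<rho> \<psi> x * tangent d \<rho> \<psi> x / \<rho> x = w"
    using pos by (simp add: tangent_def w_def power2_eq_square)
  moreover have "hess_integrand1 d f \<rho>s \<rho> \<psi> x = w * (r * deriv (deriv f) r)"
    by (simp add: hess_integrand1_def w_def r_def power2_eq_square)
  moreover have "hess_integrand2 d f \<rho>s \<rho> \<psi> x = w * (deriv f r - E)"
    by (simp add: hess_integrand2_def w_def r_def E_def)
  ultimately show ?thesis by (simp only:) argo
qed

text \<open>Integrability is asked of the integrand already scaled by \<alpha>. Thus \<alpha> = 0
  yields plain convexity even when the metric integral diverges.\<close>

lemma hessian_ge_integral:
  assumes dens: "\<rho>s \<in> densities d" "\<rho> \<in> densities d"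
    and conv: "hess_converges d f \<rho>s \<rho> \<psi>"
    and int: "integrable (leb d) (\<lambda>x. \<alpha> * (tangent d \<rho> \<psi> x * tangent d \<rho> \<psi> x / \<rho> x))"
    and bound: "\<And>r. r > 0 \<Longrightarrow> r * deriv (deriv f) r + (deriv f r - deriv f 1) / 2 \<ge> \<alpha>"
  shows "fisher_rao_hessian d f \<rho>s \<rho> \<psi>
           \<ge> \<alpha> * fisher_rao_metric d \<rho> (tangent d \<rho> \<psi>) (tangent d \<rho> \<psi>)"
proof -
  have I: "integrable (leb d) (hess_integrand1 d f \<rho>s \<rho> \<psi>)"
          "integrable (leb d) (hess_integrand2 d f \<rho>s \<rho> \<psi>)"
          "integrable (leb d) (\<lambda>x. \<rho> x * deriv f (\<rho> x / \<rho>s x))"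
    using conv by (auto simp: hess_converges_def)
  have "\<alpha> * fisher_rao_metric d \<rho> (tangent d \<rho> \<psi>) (tangent d \<rho> \<psi>)
          = (\<integral>x. \<alpha> * (tangent d \<rho> \<psi> x * tangent d \<rho> \<psi> x / \<rho> x) \<partial>leb d)"
    \<comment> \<open>This rule carries no integrability premise, which the case \<alpha> = 0 relies
      on.\<close>
    unfolding fisher_rao_metric_def by (rule integral_mult_right_zero [symmetric])
  also have "\<dots> \<le> (\<integral>x. hess_integrand1 d f \<rho>s \<rho> \<psi> x
                        + 1/2 * hess_integrand2 d f \<rho>s \<rho> \<psi> x \<partial>leb d)"
    using I
    by (intro integral_mono int hessian_integrand_ge[OF dens _ _ bound])
       (simp_all add: space_leb)
  also have "\<dots> = fisher_rao_hessian d f \<rho>s \<rho> \<psi>"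
    using I by (simp add: fisher_rao_hessian_def)
  finally show ?thesis .
qed

lemma entropy_geodesically_convex:
  assumes "\<rho>s \<in> densities d"
  shows "geodesically_convex d f \<rho>s"
  unfolding geodesically_convex_def
  using hessian_ge_integral[of _ _ _ _ 0] entropy_lower_bound_0 assms by simp

lemma entropy_strongly_geodesically_convex:
  assumes "\<rho>s \<in> densities d"
    and "\<And>r. r > 0 \<Longrightarrow> r * deriv (deriv f) r + (deriv f r - deriv f 1) / 2 \<ge> \<alpha>"
  shows "strongly_geodesically_convex \<alpha> d f \<rho>s"
  unfolding strongly_geodesically_convex_def
  by (intro ballI allI impI hessian_ge_integral integrable_mult_right assms)

end

section \<open>Power entropies\<close>

text \<open>Since \<open>deriv\<close> is total, the equation for the derivative of
  \<open>deriv f\<close> does not itself assert that \<open>f\<close> is differentiable;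
  \<open>diff\<close> does.\<close>

lemma power_entropy_assms:
  fixes f :: "real \<Rightarrow> real"
  assumes p: "p \<le> -2"
    and diff: "\<forall>x>0. f differentiable (at x)"
    and der: "\<forall>x>0. (deriv f has_real_derivative x powr p) (at x)"
    and "f 1 = 0"
  shows "entropy_assms f" and "deriv (deriv f) 1 > 0"
proof -
  have d2: "deriv (deriv f) x = x powr p" if "x > 0" for x
    using der that by (auto intro: DERIV_imp_deriv)
  then show "deriv (deriv f) 1 > 0" by simp
  have d1: "(f has_real_derivative deriv f x) (at x)" if "x > 0" for x
    using diff that by (simp add: DERIV_deriv_iff_real_differentiable)
  have "continuous_on {0<..} (deriv (deriv f)) \<longleftrightarrow> continuous_on {0<..} (\<lambda>x::real. x powr p)"
    by (intro continuous_on_cong) (auto simp: d2)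
  moreover have "continuous_on {0<..} (\<lambda>x::real. x powr p)"
    by (intro continuous_intros) auto
  moreover have "deriv f differentiable (at x)" if "x > 0" for x
    using der that real_differentiable_def by blast
  ultimately have "C2_pos f"
    using diff by (simp add: C2_pos_def)
  moreover have "convex_on {0<..} f"
    by (rule f''_ge0_imp_convex[of _ _ "deriv f" "\<lambda>x. x powr p"]) (use d1 der in auto)
  moreover have "concave_on {0<..} (\<lambda>x. x * deriv f x)"
  \<comment> \<open>The second derivative is \<open>x powr p\<close> from \<open>deriv f\<close>
    plus \<open>(p + 1) * x powr p\<close> from the product; its sign is where the threshold -2
    comes from.\<close>
  proof (rule f''_le0_imp_concave[of _ _ "\<lambda>x. deriv f x + x * x powr p" "\<lambda>x. (p + 2) * x powr p"])
    fix x :: real assume "x \<in> {0<..}"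
    then have x: "x > 0" by simp
    show "((\<lambda>x. x * deriv f x) has_real_derivative deriv f x + x * x powr p) (at x)"
      using der x by (auto intro!: derivative_eq_intros)
    show "((\<lambda>x. deriv f x + x * x powr p) has_real_derivative (p + 2) * x powr p) (at x)"
      using x der
      by (auto intro!: derivative_eq_intros simp: powr_diff field_simps)
    show "(p + 2) * x powr p \<le> 0"
      using p by (simp add: mult_nonpos_nonneg)
  qed simp
  ultimately show "entropy_assms f"
    using \<open>f 1 = 0\<close> by (simp add: entropy_assms_def)
qed

theorem theorem3p5:
  shows "(\<forall>f :: real \<Rightarrow> real. entropy_assms f \<longrightarrow>
            (\<forall>d\<ge>1. \<forall>\<rho>s\<in>densities d. geodesically_convex d f \<rho>s))
       \<and> (\<forall>f :: real \<Rightarrow> real. entropy_assms f \<and> deriv (deriv f) 1 > 0 \<longrightarrow>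
            (\<exists>\<alpha>>0. \<forall>d\<ge>1. \<forall>\<rho>s\<in>densities d. strongly_geodesically_convex \<alpha> d f \<rho>s))
       \<and> (\<forall>(f :: real \<Rightarrow> real) (p :: real). p \<le> -2 \<longrightarrow>
            (\<forall>x>0. f differentiable (at x)) \<longrightarrow>
            (\<forall>x>0. (deriv f has_real_derivative x powr p) (at x)) \<longrightarrow> f 1 = 0 \<longrightarrow>
            entropy_assms f \<and> deriv (deriv f) 1 > 0)"
proof (intro conjI allI impI)
  fix f :: "real \<Rightarrow> real"
  assume f: "entropy_assms f \<and> deriv (deriv f) 1 > 0"
  then obtain \<alpha> where "\<alpha> > 0"
    "\<And>r. r > 0 \<Longrightarrow> r * deriv (deriv f) r + (deriv f r - deriv f 1) / 2 \<ge> \<alpha>"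
    using entropy_lower_bound_pos by blast
  then show "\<exists>\<alpha>>0. \<forall>d\<ge>1. \<forall>\<rho>s\<in>densities d. strongly_geodesically_convex \<alpha> d f \<rho>s"
    using f entropy_strongly_geodesically_convex by blast
qed (use entropy_geodesically_convex power_entropy_assms in blast)+

end
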